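(* Consider the linear time-invariant system $\dot x(t)=Ax(t)+Bu(t)$, $x(0)=x_0$, for $t\in[0,\infty)$, with $A\in\mathbb{R}^{n\times n}$, $B\in\mathbb{R}^{n\times m}$, $x(t)\in\mathbb{R}^n$, $u(t)\in\mathbb{R}^m$, and the infinite-horizon cost $$J(x_0,u(\cdot))=\int_0^\infty x(t)^\top Mx(t)+u(t)^\top Ru(t)\,dt,$$ where $M=M^\top\in\mathbb{R}^{n\times n}$ is positive semi-definite and $R=R^\top\in\mathbb{R}^{m\times m}$ is positive definite. Let $P=P^\top\in\mathbb{R}^{n\times n}$, positive semi-definite, be the optimal matrix, that is, the matrix for which the value function $V(x_0)=\inf_{u(\cdot)}J(x_0,u(\cdot))$ (infimum subject to the system dynamics) is $V(x)=x^\top Px$, and which satisfies the algebraic Riccati equation $$A^\top P+PA-PBR^{-1}B^\top P+M=0.$$ Then for any arbitrary (not necessarily optimal) control $u(\cdot)$ and corresponding state trajectory $x(\cdot)$ of the system, the following equality holds along the trajectory: $$\dot V(x(t))=x(t)^\top PBR^{-1}B^\top Px(t)-x(t)^\top Mx(t)+2x(t)^\top PBu(t),$$ where $\dot V(x(t))$ denotes the time derivative of $t\mapsto V(x(t))=x(t)^\top Px(t)$.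
   Context: The setting is the infinite-horizon linear quadratic regulator problem. Controls $u(\cdot)$ are measurable functions of time with values in $\mathbb{R}^m$, and $x(t)$ is the trajectory evolving from $x_0$ at $t=0$ under $u(\cdot)$. Writing $M=C^\top C$, when the pair $(A,B)$ is stabilizable and the pair $(A,C)$ is detectable, $P$ is the unique positive semi-definite solution of the algebraic Riccati equation, and the optimal closed-loop control is $u^*=-R^{-1}B^\top Px$. The right-hand side of the equality does not contain $A$ explicitly. *)

theory Defs
  imports "HOL-Analysis.Analysis"
begin

definition pos_semidef :: "real^'n^'n \<Rightarrow> bool" where
  "pos_semidef S \<longleftrightarrow> transpose S = S \<and> (\<forall>v. 0 \<le> v \<bullet> (S *v v))"

definition pos_def :: "real^'n^'n \<Rightarrow> bool" where
  "pos_def S \<longleftrightarrow> transpose S = S \<and> (\<forall>v. v \<noteq> 0 \<longrightarrow> 0 < v \<bullet> (S *v v))"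

text \<open>A pair \<open>(l, r)\<close> in \<open>D\<close> stands for the interval from \<open>l\<close> to \<open>r\<close>; the intervals may share
  endpoints but do not overlap.\<close>

definition abs_continuous_on_interval :: "real \<Rightarrow> real \<Rightarrow> (real \<Rightarrow> 'a::real_normed_vector) \<Rightarrow> bool" where
  "abs_continuous_on_interval a b f \<longleftrightarrow>
    (\<forall>\<epsilon>>0. \<exists>\<delta>>0. \<forall>D. finite D \<and> (\<forall>(l, r)\<in>D. a \<le> l \<and> l \<le> r \<and> r \<le> b) \<and>
        pairwise (\<lambda>(l, r) (l', r'). {l<..<r} \<inter> {l'<..<r'} = {}) D \<and>
        (\<Sum>(l, r)\<in>D. r - l) < \<delta> \<longrightarrow>
      (\<Sum>(l, r)\<in>D. norm (f r - f l)) < \<epsilon>)"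

definition control :: "(real \<Rightarrow> real^'m) \<Rightarrow> bool" where
  "control u \<longleftrightarrow> u \<in> borel_measurable (lebesgue_on {0..})"

text \<open>Controls are merely measurable, so trajectories are solutions in the sense of Caratheodory:
  locally absolutely continuous, with the differential equation holding almost everywhere.
  Only the values of \<open>u\<close> and \<open>x\<close> at nonnegative times matter.\<close>

definition trajectory ::
  "real^'n^'n \<Rightarrow> real^'m^'n \<Rightarrow> real^'n \<Rightarrow> (real \<Rightarrow> real^'m) \<Rightarrow> (real \<Rightarrow> real^'n) \<Rightarrow> bool" where
  "trajectory A B x0 u x \<longleftrightarrow>
    x 0 = x0 \<and>
    (\<forall>T\<ge>0. abs_continuous_on_interval 0 T x) \<and>
    (AE t in lebesgue_on {0..}. (x has_vector_derivative A *v x t + B *v u t) (at t within {0..}))"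

text \<open>The cost may be infinite. The conversion \<^const>\<open>ennreal\<close> sends negative reals to 0, but the
  integrand is nonnegative whenever \<open>M\<close> and \<open>R\<close> are positive semi-definite.\<close>

definition cost ::
  "real^'n^'n \<Rightarrow> real^'m^'m \<Rightarrow> (real \<Rightarrow> real^'n) \<Rightarrow> (real \<Rightarrow> real^'m) \<Rightarrow> ennreal" where
  "cost M R x u =
    (\<integral>\<^sup>+ t. ennreal (x t \<bullet> (M *v x t) + u t \<bullet> (R *v u t)) \<partial>(lebesgue_on {0..}))"

text \<open>The trajectory is determined by \<open>x0\<close> and \<open>u\<close>; a control without a trajectory
  (one for which \<open>B u\<close> is not locally integrable) is not admissible.\<close>

definition value_function ::
  "real^'n^'n \<Rightarrow> real^'m^'n \<Rightarrow> real^'n^'n \<Rightarrow> real^'m^'m \<Rightarrow> real^'n \<Rightarrow> ennreal" where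
  "value_function A B M R x0 = Inf {cost M R x u | u x. control u \<and> trajectory A B x0 u x}"

end

theory Submission
  imports Defs
begin

text \<open>With V(z) = z^T P z and P symmetric, the product rule
  (\<open>has_real_derivative_quadratic_form\<close>) gives dV/dt = 2 x^T P x' = 2 x^T P A x + 2 x^T
  P B u. Reading the Riccati equation as an identity of quadratic forms
  (\<open>riccati_quadratic_form\<close>) trades 2 x^T P A x for x^T P B R^-1 B^T P x - x^T M x, so
  A disappears. The argument is pointwise in time: it works wherever x solves the differential
  equation, hence almost everywhere.\<close>

lemma has_real_derivative_quadratic_form:
  fixes P :: "real^'n^'n" and x :: "real \<Rightarrow> real^'n"
  assumes "transpose P = P" and "(x has_vector_derivative v) (at t within S)"
  shows "((\<lambda>s. x s \<bullet> (P *v x s)) has_real_derivative 2 * (x t \<bullet> (P *v v))) (at t within S)"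
proof -
  have x: "(x has_derivative (\<lambda>h. h *\<^sub>R v)) (at t within S)"
    using assms(2) by (simp add: has_vector_derivative_def)
  have Px: "((\<lambda>s. P *v x s) has_derivative (\<lambda>h. P *v (h *\<^sub>R v))) (at t within S)"
    by (rule bounded_linear.has_derivative[OF matrix_vector_mul_bounded_linear x])
  \<comment> \<open>Symmetry of \<open>P\<close> makes the two terms of the product rule equal,
    whence the factor 2.\<close>
  have "v \<bullet> (P *v x t) = x t \<bullet> (P *v v)"
    using assms(1) by (metis dot_lmul_matrix inner_commute transpose_matrix_vector)
  then show ?thesis
    unfolding has_field_derivative_def
    by (intro has_derivative_eq_rhs[OF has_derivative_inner[OF x Px]])
       (auto simp: fun_eq_iff matrix_vector_mult_scaleR algebra_simps)
qed

text \<open>A^T P and P A are transposes of each other, so they have the same quadratic form.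
  \<open>Q\<close> stands for P B R^-1 B^T P, kept opaque.\<close>

lemma riccati_quadratic_form:
  fixes A P Q M :: "real^'n^'n"
  assumes "transpose P = P" and "transpose A ** P + P ** A - Q + M = 0"
  shows "2 * (z \<bullet> (P *v (A *v z))) = z \<bullet> (Q *v z) - z \<bullet> (M *v z)"
proof -
  have "transpose A ** P + P ** A = Q - M"
    using assms(2) by (simp add: algebra_simps add_eq_0_iff)
  then have "z \<bullet> ((transpose A ** P + P ** A) *v z) = z \<bullet> ((Q - M) *v z)"
    by simp
  moreover have "z \<bullet> (transpose A *v (P *v z)) = z \<bullet> (P *v (A *v z))"
    using assms(1) by (metis dot_lmul_matrix inner_commute transpose_matrix_vector)
  ultimately show ?thesis
    by (simp add: matrix_vector_mult_add_rdistrib matrix_vector_mult_diff_rdistrib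
        inner_add_right inner_diff_right flip: matrix_vector_mul_assoc)
qed

theorem mainTheorem1:
  fixes A M P :: "real^'n^'n" and B :: "real^'m^'n" and R :: "real^'m^'m"
    and x0 :: "real^'n" and u :: "real \<Rightarrow> real^'m" and x :: "real \<Rightarrow> real^'n"
  defines "V \<equiv> (\<lambda>z. enn2real (value_function A B M R z))"
    and "rhs \<equiv> (\<lambda>t. x t \<bullet> ((P ** B ** matrix_inv R ** transpose B ** P) *v x t)
                  - x t \<bullet> (M *v x t) + 2 * (x t \<bullet> ((P ** B) *v u t)))"
  assumes "pos_semidef M"
    and "pos_def R"
    and "pos_semidef P"
    and "\<And>z. value_function A B M R z = ennreal (z \<bullet> (P *v z))"
    and "transpose A ** P + P ** A - P ** B ** matrix_inv R ** transpose B ** P + M = 0"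
    and "control u"
    and "trajectory A B x0 u x"
  shows "(AE t in lebesgue_on {0..}.
            ((\<lambda>s. V (x s)) has_real_derivative rhs t) (at t within {0..})) \<and>
         (\<forall>t\<ge>0. (x has_vector_derivative A *v x t + B *v u t) (at t within {0..}) \<longrightarrow>
            ((\<lambda>s. V (x s)) has_real_derivative rhs t) (at t within {0..}))"
proof -
  have P: "transpose P = P" and "\<And>z. 0 \<le> z \<bullet> (P *v z)"
    using assms(5) by (auto simp: pos_semidef_def)
  \<comment> \<open>Nonnegativity of the form is what lets \<open>enn2real\<close> undo
    \<open>ennreal\<close>, which would truncate negative values to 0.\<close>
  then have V: "V = (\<lambda>z. z \<bullet> (P *v z))"
    using assms(6) by (simp add: V_def)
  \<comment> \<open>This is the second conjunct up to the restriction to nonnegative times; the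
    first follows since almost every time qualifies.\<close>
  have deriv: "((\<lambda>s. V (x s)) has_real_derivative rhs t) (at t within {0..})"
    if "(x has_vector_derivative A *v x t + B *v u t) (at t within {0..})" for t
  proof -
    \<comment> \<open>The Riccati identity rewrites only the \<open>A\<close> part; the
      \<open>B *v u t\<close> part is already the last term of \<open>rhs\<close>.\<close>
    have "2 * (x t \<bullet> (P *v (A *v x t + B *v u t))) = rhs t"
      using riccati_quadratic_form[OF P assms(7), of "x t"]
      by (simp add: rhs_def matrix_vector_right_distrib inner_add_right flip: matrix_vector_mul_assoc)
    then show ?thesis
      using has_real_derivative_quadratic_form[OF P that] by (simp add: V)
  qed
  moreover have "AE t in lebesgue_on {0..}. (x has_vector_derivative A *v x t + B *v u t) (at t within {0..})"
    using assms(9) by (simp add: trajectory_def)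
  ultimately show ?thesis
    by auto
qed

end
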